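(* Let $H$ be a real Hilbert space, $K\subset H$ a nonempty closed convex set, and let $f,g:K\times K\to\mathbb{R}$ be monotone, upper hemicontinuous equilibrium bifunctions satisfying the standing assumptions listed in the context. Suppose that $S_f\neq\emptyset$ and that $g$ is $\rho$-strongly monotone for some $\rho>0$. Let $\{\lambda_n\}$ and $\{\beta_n\}$ be sequences of positive reals such that $$\lim_{n\to+\infty}\lambda_n=0,\qquad \sum_{n=0}^{+\infty}\lambda_n=+\infty,\qquad \lim_{n\to+\infty}\beta_n=+\infty,\qquad \liminf_{n\to+\infty}\lambda_n\beta_n>0,$$ and let $0\leq\alpha<\frac13$. Let $x_0,x_1\in K$ and let $\{x_n\}\subset K$ be a sequence such that for every $n\geq 1$, with $y_n:=x_n+\alpha(x_n-x_{n-1})$, $$\beta_n f(x_{n+1},y)+g(x_{n+1},y)+\frac{1}{\lambda_n}\langle x_{n+1}-y_n,\,y-x_{n+1}\rangle\geq 0\qquad\text{for all } y\in K.$$ Then the sequence $\{x_n\}$ converges strongly to the unique solution $u$ of (BEP).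
   Context: A bifunction $f:K\times K\to\mathbb{R}$ is: monotone if $f(x,y)+f(y,x)\leq 0$ for all $x,y\in K$; $\rho$-strongly monotone ($\rho>0$) if $f(x,y)+f(y,x)\leq-\rho\|x-y\|^2$ for all $x,y\in K$; upper hemicontinuous if $\lim_{t\searrow 0}f(tz+(1-t)x,y)\leq f(x,y)$ for all $x,y,z\in K$; an equilibrium bifunction if for each $x\in K$, $f(x,x)=0$ and $f(x,\cdot)$ is convex and lower semicontinuous on $K$. $S_f:=\{u\in K: f(u,y)\geq 0\ \forall y\in K\}$. The bilevel equilibrium problem (BEP) is: find $\bar x\in S_f$ such that $g(\bar x,y)\geq 0$ for all $y\in S_f$; $S$ denotes its solution set. For $u\in K$, $g_u:H\to\mathbb{R}\cup\{+\infty\}$ is $g_u(x)=g(u,x)$ if $x\in K$ and $+\infty$ otherwise; $\partial$ is the convex subdifferential. Standing assumptions: $S\neq\emptyset$; for each $y\in K$, $\partial g_y(y)\neq\emptyset$; $K\cap S_f\neq\emptyset$ and $\mathbb{R}_+(K-S_f)$ is a closed linear subspace of $H$. *)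

theory Defs
  imports "HOL-Analysis.Analysis"
begin

text \<open>
  A bifunction on \<open>K\<close> is a total function of two arguments, of which only the values on
  \<open>K \<times> K\<close> are ever used. Real Hilbert spaces are the types of sort
  \<open>{real_inner, complete_space}\<close>.
\<close>

definition monotone_bifun :: "'a set \<Rightarrow> ('a \<Rightarrow> 'a \<Rightarrow> real) \<Rightarrow> bool" where
  "monotone_bifun K f \<longleftrightarrow> (\<forall>x\<in>K. \<forall>y\<in>K. f x y + f y x \<le> 0)"

definition strongly_monotone_bifun ::
    "real \<Rightarrow> 'a::real_inner set \<Rightarrow> ('a \<Rightarrow> 'a \<Rightarrow> real) \<Rightarrow> bool" where
  "strongly_monotone_bifun \<rho> K f \<longleftrightarrow>
     (\<forall>x\<in>K. \<forall>y\<in>K. f x y + f y x \<le> - \<rho> * (norm (x - y))\<^sup>2)"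

text \<open>
  The one-sided limit is taken as an upper limit in the extended reals, so that its existence
  is not an additional requirement; it is the limit itself whenever that exists.
\<close>

definition upper_hemicontinuous ::
    "'a::real_vector set \<Rightarrow> ('a \<Rightarrow> 'a \<Rightarrow> real) \<Rightarrow> bool" where
  "upper_hemicontinuous K f \<longleftrightarrow>
     (\<forall>x\<in>K. \<forall>y\<in>K. \<forall>z\<in>K.
        Limsup (at_right (0::real)) (\<lambda>t. ereal (f (t *\<^sub>R z + (1 - t) *\<^sub>R x) y)) \<le> ereal (f x y))"

definition lower_semicontinuous_on :: "'a::topological_space set \<Rightarrow> ('a \<Rightarrow> real) \<Rightarrow> bool" where
  "lower_semicontinuous_on K h \<longleftrightarrow>
     (\<forall>x\<in>K. ereal (h x) \<le> Liminf (at x within K) (\<lambda>y. ereal (h y)))"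

definition equilibrium_bifun :: "'a::real_normed_vector set \<Rightarrow> ('a \<Rightarrow> 'a \<Rightarrow> real) \<Rightarrow> bool" where
  "equilibrium_bifun K f \<longleftrightarrow>
     (\<forall>x\<in>K. f x x = 0 \<and> convex_on K (f x) \<and> lower_semicontinuous_on K (f x))"

definition ep_solutions :: "'a set \<Rightarrow> ('a \<Rightarrow> 'a \<Rightarrow> real) \<Rightarrow> 'a set" where
  "ep_solutions K f = {u \<in> K. \<forall>y\<in>K. f u y \<ge> 0}"

definition bep_solutions ::
    "'a set \<Rightarrow> ('a \<Rightarrow> 'a \<Rightarrow> real) \<Rightarrow> ('a \<Rightarrow> 'a \<Rightarrow> real) \<Rightarrow> 'a set" where
  "bep_solutions K f g = {u \<in> ep_solutions K f. \<forall>y\<in>ep_solutions K f. g u y \<ge> 0}"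

definition extend_by_infinity :: "'a set \<Rightarrow> ('a \<Rightarrow> real) \<Rightarrow> 'a \<Rightarrow> ereal" where
  "extend_by_infinity K h x = (if x \<in> K then ereal (h x) else \<infinity>)"

text \<open>Subgradients are elements of the space itself, by the Riesz identification of the dual.\<close>

definition subdifferential :: "('a::real_inner \<Rightarrow> ereal) \<Rightarrow> 'a \<Rightarrow> 'a set" where
  "subdifferential \<phi> x =
     {p. \<bar>\<phi> x\<bar> \<noteq> \<infinity> \<and> (\<forall>y. \<phi> x + ereal (p \<bullet> (y - x)) \<le> \<phi> y)}"

definition cone_of_differences :: "'a::real_vector set \<Rightarrow> 'a set \<Rightarrow> 'a set" where
  "cone_of_differences A B = {r *\<^sub>R (a - b) | r a b. r \<ge> 0 \<and> a \<in> A \<and> b \<in> B}"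

end

theory Submission
  imports Defs
begin

text \<open>
  Let \<open>u\<close> be the solution of the bilevel problem; strong monotonicity of \<open>g\<close> makes it unique.
  Write \<open>a n\<close> for the squared distance from \<open>x n\<close> to \<open>u\<close> and \<open>d n\<close> for the squared length of
  the step from \<open>x (n - 1)\<close> to \<open>x n\<close>. Testing the proximal inequality with \<open>y = u\<close>, where
  monotonicity gives \<open>f (x (n + 1)) u \<le> 0\<close>, shows that the energy
  \<open>E n = a n - \<alpha> * a (n - 1) + (1 + \<alpha>) / 2 * d n\<close> satisfies
  \<open>E (n + 1) + \<gamma> * (d (n + 1) + d n) \<le> E n + 2 * lam n * (- g u (x (n + 1)) - \<rho> * a (n + 1))\<close>
  with \<open>\<gamma> = (1 - 3 * \<alpha>) / 2\<close> (\<open>inertial_energy_step\<close>, \<open>proximal_step_distance\<close>). For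
  \<open>\<alpha> < 1/3\<close> the constant \<open>\<gamma>\<close> is positive and \<open>E n\<close> lies between \<open>a n / 3\<close> and
  \<open>a n + d n\<close>. As \<open>g u\<close> is bounded below by a linear function, which the quadratic term
  \<open>\<rho> * a (n + 1)\<close> dominates far from \<open>u\<close>, the energy is bounded.

  The energy need not decrease, since \<open>g u (x (n + 1))\<close> may be negative as long as \<open>x (n + 1)\<close>
  is not in the solution set of \<open>f\<close>. However, call an index bad if
  \<open>E (n + 1) \<ge> \<epsilon>\<close> and yet \<open>E\<close> fails to drop by \<open>\<rho> * \<epsilon> * lam n\<close>. At bad indices the energy
  inequality bounds both steps by a multiple of \<open>lam n\<close>, so they tend to zero; because
  \<open>\<beta> n\<close> tends to infinity and \<open>lam n * \<beta> n\<close> stays away from zero, the proximal inequality then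
  forces the upper limit of \<open>f y (x (n + 1))\<close> along the bad indices to be at most 0 for every
  \<open>y\<close> in \<open>K\<close>. A weak cluster point of such iterates solves the lower level problem, by
  Minty's argument, and \<open>g u\<close> is nonnegative there; hence \<open>g u (x (n + 1))\<close> is asymptotically
  nonnegative along the bad indices (\<open>asymptotically_feasible_upper_value\<close>). Put back into the
  energy inequality, this contradicts \<open>E (n + 1) \<ge> \<epsilon>\<close>, so only finitely many indices are bad.
  Since the series of the \<open>lam n\<close> diverges, the energy must fall below \<open>\<epsilon>\<close>, and from
  then on it stays there (\<open>tendsto_zero_of_conditional_descent\<close>).
\<close>

section \<open>Weak cluster points through closed convex sets\<close>

text \<open>
  This is the form of weak compactness of bounded sets that the proof uses. Almost
  norm-minimal points of the sets form a Cauchy sequence by the parallelogram law, because the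
  midpoint of two of them lies in the larger of the two sets.
\<close>

lemma nested_closed_convex_Inter_nonempty:
  fixes C :: "nat \<Rightarrow> 'a::{real_inner, complete_space} set"
  assumes ne: "\<And>n. C n \<noteq> {}" and cl: "\<And>n. closed (C n)" and cv: "\<And>n. convex (C n)"
    and bd: "bounded (C 0)" and dec: "decseq C"
  shows "\<exists>z. \<forall>n. z \<in> C n"
proof -
  have sub: "C n \<subseteq> C m" if "m \<le> n" for m n
    using dec that by (simp add: decseq_def)
  obtain B where B: "\<And>z. z \<in> C 0 \<Longrightarrow> norm z \<le> B"
    using bd by (auto simp: bounded_iff)
  define \<delta> where "\<delta> n = (INF z\<in>C n. (norm z)\<^sup>2)" for n
  have bdd: "bdd_below ((\<lambda>z. (norm z)\<^sup>2) ` C n)" for n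
    by (rule bdd_belowI[of _ 0]) auto
  have \<delta>_le: "\<delta> n \<le> (norm z)\<^sup>2" if "z \<in> C n" for n z
    unfolding \<delta>_def by (rule cINF_lower[OF bdd that])
  have \<delta>_mono: "\<delta> m \<le> \<delta> n" if "m \<le> n" for m n
    unfolding \<delta>_def by (rule cINF_superset_mono[OF ne bdd sub[OF that]]) simp
  have \<delta>_bd: "\<delta> n \<le> B\<^sup>2" for n
  proof -
    obtain z where z: "z \<in> C n" using ne by blast
    with sub[of 0 n] B have "norm z \<le> B" by auto
    then have "(norm z)\<^sup>2 \<le> B\<^sup>2" by (rule power_mono) simp
    with \<delta>_le[OF z] show ?thesis by simp
  qed
  have "\<exists>z\<in>C n. (norm z)\<^sup>2 < \<delta> n + inverse (real (Suc n))" for n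
  proof -
    have "(INF z\<in>C n. (norm z)\<^sup>2) < \<delta> n + inverse (real (Suc n))"
      unfolding \<delta>_def by simp
    then show ?thesis using cINF_less_iff[OF ne bdd] by blast
  qed
  then obtain p where pC: "\<And>n. p n \<in> C n"
    and p: "\<And>n. (norm (p n))\<^sup>2 < \<delta> n + inverse (real (Suc n))"
    by metis
  have \<delta>_nonneg: "0 \<le> \<delta> n" for n
    unfolding \<delta>_def by (rule cINF_greatest[OF ne]) simp
  have "Bseq \<delta>"
    using \<delta>_nonneg \<delta>_bd by (intro BseqI'[of _ "B\<^sup>2"]) simp
  then have "convergent \<delta>"
    by (rule Bseq_monoseq_convergent) (use \<delta>_mono in \<open>simp add: monoseq_def\<close>)
  then have "Cauchy \<delta>" by (rule convergent_Cauchy)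
  have dist_p: "(dist (p m) (p n))\<^sup>2 \<le> 2 * (\<delta> n - \<delta> m) + 4 * inverse (real (Suc m))" if mn: "m \<le> n" for m n
  proof -
    have pn: "p n \<in> C m" using pC sub[OF mn] by blast
    have "(1/2) *\<^sub>R p m + (1/2) *\<^sub>R p n \<in> C m"
      by (rule convexD[OF cv pC pn]) auto
    then have "\<delta> m \<le> (norm ((1/2) *\<^sub>R p m + (1/2) *\<^sub>R p n))\<^sup>2" by (rule \<delta>_le)
    also have "\<dots> = (norm (p m + p n))\<^sup>2 / 4"
      by (simp add: scaleR_add_right[symmetric] power_divide)
    finally have mid: "4 * \<delta> m \<le> (norm (p m + p n))\<^sup>2" by simp
    have par: "(norm (p m + p n))\<^sup>2 + (norm (p m - p n))\<^sup>2 = 2 * (norm (p m))\<^sup>2 + 2 * (norm (p n))\<^sup>2"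
      by (simp add: power2_norm_eq_inner algebra_simps)
    have "inverse (real (Suc n)) \<le> inverse (real (Suc m))"
      using mn by (intro le_imp_inverse_le) auto
    with mid par p[of m] p[of n] show ?thesis
      unfolding dist_norm by argo
  qed
  have "Cauchy p"
  proof (rule metric_CauchyI)
    fix e :: real assume e: "0 < e"
    then have e2: "0 < e\<^sup>2 / 8" by simp
    obtain M1 where M1: "\<And>m n. m \<ge> M1 \<Longrightarrow> n \<ge> M1 \<Longrightarrow> dist (\<delta> m) (\<delta> n) < e\<^sup>2 / 8"
      using metric_CauchyD[OF \<open>Cauchy \<delta>\<close> e2] by blast
    obtain M2 where M2: "inverse (real (Suc M2)) < e\<^sup>2 / 8"
      using reals_Archimedean[OF e2] by blast
    have key: "dist (p m) (p n) < e" if "m \<ge> max M1 M2" "m \<le> n" for m n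
    proof -
      have "inverse (real (Suc m)) \<le> inverse (real (Suc M2))"
        using that by (intro le_imp_inverse_le) auto
      moreover have "\<delta> n - \<delta> m < e\<^sup>2 / 8"
        using M1[of m n] that abs_ge_minus_self[of "\<delta> m - \<delta> n"] unfolding dist_real_def by linarith
      ultimately have "(dist (p m) (p n))\<^sup>2 < e\<^sup>2"
        using dist_p[OF that(2)] M2 e2 by argo
      then show ?thesis using e by (meson less_eq_real_def power2_less_imp_less)
    qed
    show "\<exists>M. \<forall>m\<ge>M. \<forall>n\<ge>M. dist (p m) (p n) < e"
    proof (intro exI allI impI)
      fix m n assume "max M1 M2 \<le> m" "max M1 M2 \<le> n"
      then show "dist (p m) (p n) < e"
        using key[of m n] key[of n m] by (cases "m \<le> n") (auto simp: dist_commute)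
    qed
  qed
  then obtain z where z: "p \<longlonglongrightarrow> z"
    using Cauchy_convergent_iff convergent_def by blast
  have "z \<in> C n" for n
  proof (rule Lim_in_closed_set[OF cl _ _ z])
    show "\<forall>\<^sub>F m in sequentially. p m \<in> C n"
      using eventually_ge_at_top[of n] by eventually_elim (use pC sub in blast)
  qed simp
  then show ?thesis by blast
qed

text \<open>
  The point \<open>z\<close> plays the role of a weak limit of a subsequence of \<open>s\<close> along indices satisfying
  \<open>P\<close>: it lies in the closed convex hull of every tail of these indices. Stating the
  conclusion for arbitrary closed convex sets avoids the weak topology and lets one \<open>z\<close> serve
  uncountably many sets at once.
\<close>

lemma bounded_frequently_weak_cluster_point:
  fixes s :: "nat \<Rightarrow> 'a::{real_inner, complete_space}"
  assumes bd: "bounded (range s)" and fr: "\<exists>\<^sub>F n in sequentially. P n"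
  obtains z where "\<And>C. closed C \<Longrightarrow> convex C \<Longrightarrow> (\<forall>\<^sub>F n in sequentially. P n \<longrightarrow> s n \<in> C) \<Longrightarrow> z \<in> C"
proof -
  define T where "T N = closure (convex hull (s ` {n. N \<le> n \<and> P n}))" for N
  have "\<exists>z. \<forall>N. z \<in> T N"
  proof (rule nested_closed_convex_Inter_nonempty)
    fix N
    obtain n where "N \<le> n" "P n"
      using fr by (auto simp: frequently_sequentially)
    then show "T N \<noteq> {}" by (auto simp: T_def)
    show "closed (T N)" "convex (T N)" by (simp_all add: T_def convex_closure)
  next
    have "bounded (s ` {n. 0 \<le> n \<and> P n})"
      by (rule bounded_subset[OF bd]) auto
    then show "bounded (T 0)" by (simp add: T_def bounded_closure bounded_convex_hull)
    show "decseq T"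
      unfolding T_def decseq_def by (intro allI impI closure_mono hull_mono) auto
  qed
  then obtain z where z: "\<And>N. z \<in> T N" by blast
  show ?thesis
  proof
    fix C assume C: "closed C" "convex C" "\<forall>\<^sub>F n in sequentially. P n \<longrightarrow> s n \<in> C"
    then obtain N where "\<And>n. N \<le> n \<Longrightarrow> P n \<Longrightarrow> s n \<in> C"
      by (auto simp: eventually_sequentially)
    then have "T N \<subseteq> C"
      unfolding T_def using C by (intro closure_minimal hull_minimal) auto
    then show "z \<in> C" using z by blast
  qed
qed

lemma closed_sublevel_set:
  assumes K: "closed K" and h: "lower_semicontinuous_on K h"
  shows "closed {x\<in>K. h x \<le> c}"
  unfolding closed_limpt
proof (intro allI impI)
  fix x assume lim: "x islimpt {x\<in>K. h x \<le> c}"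
  then have "x islimpt K" by (rule islimpt_subset) auto
  then have xK: "x \<in> K" using K by (simp add: closed_limpt)
  have "h x \<le> c"
  proof (rule ccontr)
    assume "\<not> h x \<le> c"
    then have "ereal c < ereal (h x)" by simp
    also have "\<dots> \<le> Liminf (at x within K) (\<lambda>y. ereal (h y))"
      using h xK by (simp add: lower_semicontinuous_on_def)
    finally have "\<forall>\<^sub>F y in at x within K. ereal c < ereal (h y)"
      by (rule less_LiminfD)
    then obtain U where U: "open U" "x \<in> U" "\<And>y. y \<in> U \<Longrightarrow> y \<noteq> x \<Longrightarrow> y \<in> K \<Longrightarrow> c < h y"
      by (auto simp: eventually_at_topological)
    obtain y where "y \<in> {x\<in>K. h x \<le> c}" "y \<in> U" "y \<noteq> x"
      using islimptE[OF lim U(2,1)] by blast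
    with U(3)[of y] show False by simp
  qed
  then show "x \<in> {x\<in>K. h x \<le> c}" using xK by simp
qed

lemma convex_sublevel_set:
  assumes "convex_on K h"
  shows "convex {x\<in>K. h x \<le> c}"
proof (rule convexI)
  fix x y and s t :: real
  assume xy: "x \<in> {x\<in>K. h x \<le> c}" "y \<in> {x\<in>K. h x \<le> c}" and st: "0 \<le> s" "0 \<le> t" "s + t = 1"
  have "s *\<^sub>R x + t *\<^sub>R y \<in> K"
    using convexD[OF convex_on_imp_convex[OF assms]] xy st by simp
  moreover have "h (s *\<^sub>R x + t *\<^sub>R y) \<le> s * h x + t * h y"
    using assms xy st by (simp add: convex_on_def)
  moreover have "s * h x + t * h y \<le> s * c + t * c"
    using xy st by (intro add_mono mult_left_mono) auto
  moreover have "s * c + t * c = c" using st by (simp add: distrib_right[symmetric])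
  ultimately show "s *\<^sub>R x + t *\<^sub>R y \<in> {x\<in>K. h x \<le> c}" by simp
qed

section \<open>Equilibrium problems\<close>

text \<open>
  Minty's argument: on the segment from \<open>z\<close> to \<open>y\<close>, the equation \<open>f w w = 0\<close> and convexity
  of \<open>f w\<close> turn \<open>f w z \<le> 0\<close> into \<open>f w y \<ge> 0\<close>, and the latter passes to the limit
  \<open>w \<rightarrow> z\<close> by upper hemicontinuity.
\<close>

lemma minty_equilibrium:
  fixes K :: "'a::real_normed_vector set"
  assumes K: "convex K" and uh: "upper_hemicontinuous K f" and eq: "equilibrium_bifun K f"
    and z: "z \<in> K" and dual: "\<And>y. y \<in> K \<Longrightarrow> f y z \<le> 0"
  shows "z \<in> ep_solutions K f"
proof -
  have "0 \<le> f z y" if y: "y \<in> K" for y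
  proof -
    have nonneg: "0 \<le> f (t *\<^sub>R y + (1 - t) *\<^sub>R z) y" if t: "0 < t" "t < 1" for t
    proof -
      define w where "w = t *\<^sub>R y + (1 - t) *\<^sub>R z"
      have w: "w \<in> K" unfolding w_def using convexD[OF K y z] t by simp
      then have "f w w = 0" and cv: "convex_on K (f w)"
        using eq by (auto simp: equilibrium_bifun_def)
      moreover have "f w (t *\<^sub>R y + (1 - t) *\<^sub>R z) \<le> t * f w y + (1 - t) * f w z"
        using cv y z t by (simp add: convex_on_def)
      ultimately have "0 \<le> t * f w y + (1 - t) * f w z" unfolding w_def by simp
      also have "\<dots> \<le> t * f w y"
        using dual[OF w] t by (simp add: mult_nonneg_nonpos)
      finally have "0 \<le> f w y" using t by (simp add: zero_le_mult_iff)
      then show ?thesis by (simp add: w_def)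
    qed
    have "0 \<le> Limsup (at_right (0::real)) (\<lambda>t. ereal (f (t *\<^sub>R y + (1 - t) *\<^sub>R z) y))"
    proof (rule le_Limsup)
      have "\<forall>\<^sub>F t in at_right (0::real). t \<in> {0<..<1}"
        by (rule eventually_at_right_real) simp
      then show "\<forall>\<^sub>F t in at_right 0. 0 \<le> ereal (f (t *\<^sub>R y + (1 - t) *\<^sub>R z) y)"
        by eventually_elim (use nonneg in simp)
    qed simp
    also have "\<dots> \<le> ereal (f z y)"
      using uh z y by (simp add: upper_hemicontinuous_def)
    finally show ?thesis by simp
  qed
  then show ?thesis using z by (simp add: ep_solutions_def)
qed

text \<open>
  Otherwise a cluster point taken along indices with \<open>P n\<close> and \<open>g u (s n) \<le> - \<eta>\<close> lies in the
  corresponding sublevel sets of \<open>g u\<close> and of every \<open>f y\<close>, which are closed and convex; by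
  Minty's argument it solves the lower level problem, against the optimality of \<open>u\<close>.
\<close>

lemma asymptotically_feasible_upper_value:
  fixes K :: "'a::{real_inner, complete_space} set"
  assumes clK: "closed K" and cvK: "convex K"
    and f: "upper_hemicontinuous K f" "equilibrium_bifun K f" and g: "equilibrium_bifun K g"
    and u: "u \<in> bep_solutions K f g"
    and sK: "\<And>n. s n \<in> K" and bd: "bounded (range s)"
    and feas: "\<And>y e. y \<in> K \<Longrightarrow> 0 < e \<Longrightarrow> \<forall>\<^sub>F n in sequentially. P n \<longrightarrow> f y (s n) \<le> e"
    and \<eta>: "0 < \<eta>"
  shows "\<forall>\<^sub>F n in sequentially. P n \<longrightarrow> - \<eta> < g u (s n)"
proof (rule ccontr)
  assume "\<not> ?thesis"
  then have fr: "\<exists>\<^sub>F n in sequentially. P n \<and> g u (s n) \<le> - \<eta>"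
    by (simp add: not_eventually not_less)
  obtain z where z: "\<And>C. closed C \<Longrightarrow> convex C \<Longrightarrow>
      (\<forall>\<^sub>F n in sequentially. (P n \<and> g u (s n) \<le> - \<eta>) \<longrightarrow> s n \<in> C) \<Longrightarrow> z \<in> C"
    using bounded_frequently_weak_cluster_point[OF bd fr] by blast
  have sublevel: "z \<in> {x\<in>K. h y x \<le> c}"
    if "equilibrium_bifun K h" "y \<in> K"
      "\<forall>\<^sub>F n in sequentially. (P n \<and> g u (s n) \<le> - \<eta>) \<longrightarrow> h y (s n) \<le> c" for h y c
    using that sK clK
    by (intro z closed_sublevel_set convex_sublevel_set) (auto simp: equilibrium_bifun_def)
  have uK: "u \<in> K" and u_opt: "\<And>y. y \<in> ep_solutions K f \<Longrightarrow> 0 \<le> g u y"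
    using u by (auto simp: bep_solutions_def ep_solutions_def)
  have zg: "z \<in> {x\<in>K. g u x \<le> - \<eta>}"
    by (rule sublevel[OF g uK]) simp
  have "f y z \<le> 0" if y: "y \<in> K" for y
  proof (rule field_le_epsilon)
    fix e :: real assume "0 < e"
    from feas[OF y this]
    have "\<forall>\<^sub>F n in sequentially. (P n \<and> g u (s n) \<le> - \<eta>) \<longrightarrow> f y (s n) \<le> e"
      by eventually_elim simp
    from sublevel[OF f(2) y this] show "f y z \<le> 0 + e" by simp
  qed
  then have "z \<in> ep_solutions K f"
    using zg by (intro minty_equilibrium cvK f) auto
  with u_opt zg \<eta> show False by fastforce
qed

lemma bep_solution_unique:
  fixes K :: "'a::real_inner set"
  assumes g: "strongly_monotone_bifun \<rho> K g" and \<rho>: "0 < \<rho>"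
    and u: "u \<in> bep_solutions K f g" and v: "v \<in> bep_solutions K f g"
  shows "u = v"
proof -
  have "0 \<le> g u v + g v u"
    using u v by (simp add: bep_solutions_def)
  also have "\<dots> \<le> - \<rho> * (norm (u - v))\<^sup>2"
    using g u v by (simp add: strongly_monotone_bifun_def bep_solutions_def ep_solutions_def)
  finally show ?thesis using \<rho> by (simp add: mult_le_0_iff)
qed

lemma equilibrium_subgradient:
  fixes K :: "'a::real_inner set"
  assumes g: "equilibrium_bifun K g" and y: "y \<in> K"
    and sd: "subdifferential (extend_by_infinity K (g y)) y \<noteq> {}"
  obtains q where "\<And>z. z \<in> K \<Longrightarrow> q \<bullet> (z - y) \<le> g y z"
proof -
  obtain q where q: "\<And>z. extend_by_infinity K (g y) y + ereal (q \<bullet> (z - y)) \<le> extend_by_infinity K (g y) z"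
    using sd by (auto simp: subdifferential_def)
  have "g y y = 0" using g y by (simp add: equilibrium_bifun_def)
  then have "q \<bullet> (z - y) \<le> g y z" if "z \<in> K" for z
    using q[of z] that y by (simp add: extend_by_infinity_def)
  then show thesis by (rule that)
qed

section \<open>The inertial proximal step\<close>

text \<open>
  Here \<open>a\<close> and \<open>b\<close> are the previous and the current iterate. The distance terms come from
  expanding the inertial step. The weight \<open>(1 + \<alpha>) / 2\<close> is the midpoint of \<open>2 * \<alpha>\<close> and
  \<open>1 - \<alpha>\<close>, the coefficients of the old and the new squared step in that expansion: this way both
  steps keep the coefficient \<open>(1 - 3 * \<alpha>) / 2\<close> in \<open>inertial_energy_step\<close>, and the
  smallness of both is needed to control the distance to the extrapolated point.
\<close>

definition inertial_energy :: "real \<Rightarrow> 'a::real_inner \<Rightarrow> 'a \<Rightarrow> 'a \<Rightarrow> real" where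
  "inertial_energy \<alpha> u a b =
     (norm (b - u))\<^sup>2 - \<alpha> * (norm (a - u))\<^sup>2 + (1 + \<alpha>) / 2 * (norm (b - a))\<^sup>2"

lemma inertial_energy_lower:
  assumes \<alpha>: "0 \<le> \<alpha>" "\<alpha> < 1/3"
  shows "(norm (b - u))\<^sup>2 / 3 \<le> inertial_energy \<alpha> u a b"
proof -
  \<comment> \<open>the parallelogram law for \<open>b - u\<close> and \<open>b - a\<close>, whose difference is \<open>a - u\<close>\<close>
  have "2 * ((norm (b - u))\<^sup>2 + (norm (b - a))\<^sup>2) - (norm (a - u))\<^sup>2 = (norm ((b - u) + (b - a)))\<^sup>2"
    by (simp add: power2_norm_eq_inner algebra_simps inner_commute)
  then have "(norm (a - u))\<^sup>2 \<le> 2 * ((norm (b - u))\<^sup>2 + (norm (b - a))\<^sup>2)"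
    by (smt (verit) zero_le_power2)
  then have "\<alpha> * (norm (a - u))\<^sup>2 \<le> \<alpha> * (2 * ((norm (b - u))\<^sup>2 + (norm (b - a))\<^sup>2))"
    using \<alpha> by (intro mult_left_mono)
  then have "\<alpha> * (norm (a - u))\<^sup>2 \<le> 2 * (\<alpha> * (norm (b - u))\<^sup>2) + 2 * (\<alpha> * (norm (b - a))\<^sup>2)"
    by (simp add: algebra_simps)
  moreover have "\<alpha> * (norm (b - u))\<^sup>2 \<le> 1/3 * (norm (b - u))\<^sup>2"
    and "\<alpha> * (norm (b - a))\<^sup>2 \<le> 1/3 * (norm (b - a))\<^sup>2"
    using \<alpha> by (intro mult_right_mono; simp)+
  moreover have "inertial_energy \<alpha> u a b = (norm (b - u))\<^sup>2 - \<alpha> * (norm (a - u))\<^sup>2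
      + (norm (b - a))\<^sup>2 / 2 + \<alpha> * (norm (b - a))\<^sup>2 / 2"
    by (simp add: inertial_energy_def field_simps)
  ultimately show ?thesis by linarith
qed

lemma inertial_energy_upper:
  assumes \<alpha>: "0 \<le> \<alpha>" "\<alpha> < 1/3"
  shows "inertial_energy \<alpha> u a b \<le> (norm (b - u))\<^sup>2 + (norm (b - a))\<^sup>2"
proof -
  have "0 \<le> \<alpha> * (norm (a - u))\<^sup>2" using \<alpha> by simp
  moreover have "(1 + \<alpha>) / 2 * (norm (b - a))\<^sup>2 \<le> 1 * (norm (b - a))\<^sup>2"
    using \<alpha> by (intro mult_right_mono) auto
  ultimately show ?thesis unfolding inertial_energy_def by simp
qed

text \<open>
  The difference of the two sides is \<open>\<alpha>\<close> times the squared norm of the second difference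
  \<open>(c - b) - (b - a)\<close>.
\<close>

lemma inertial_energy_step:
  fixes a b c u :: "'a::real_inner"
  assumes \<alpha>: "0 \<le> \<alpha>"
  shows "inertial_energy \<alpha> u b c + (1 - 3 * \<alpha>) / 2 * ((norm (c - b))\<^sup>2 + (norm (b - a))\<^sup>2)
    \<le> inertial_energy \<alpha> u a b + 2 * ((c - (b + \<alpha> *\<^sub>R (b - a))) \<bullet> (c - u))"
proof -
  define p v z where "p = c - b" and "v = b - a" and "z = b - u"
  have [simp]: "c - u = p + z" "b - u = z" "a - u = z - v" "c - b = p" "b - a = v"
    "c - (b + \<alpha> *\<^sub>R v) = p - \<alpha> *\<^sub>R v"
    by (simp_all add: p_def v_def z_def)
  have eqs: "(norm (p + z))\<^sup>2 = p \<bullet> p + 2 * (p \<bullet> z) + z \<bullet> z"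
    "(norm (z - v))\<^sup>2 = z \<bullet> z - 2 * (v \<bullet> z) + v \<bullet> v"
    "(norm (p - v))\<^sup>2 = p \<bullet> p - 2 * (p \<bullet> v) + v \<bullet> v"
    "(p - \<alpha> *\<^sub>R v) \<bullet> (p + z) = p \<bullet> p + p \<bullet> z - \<alpha> * (p \<bullet> v) - \<alpha> * (v \<bullet> z)"
    by (simp_all add: power2_norm_eq_inner inner_simps inner_commute algebra_simps)
  have "inertial_energy \<alpha> u a b + 2 * ((c - (b + \<alpha> *\<^sub>R (b - a))) \<bullet> (c - u))
      - (inertial_energy \<alpha> u b c + (1 - 3 * \<alpha>) / 2 * ((norm (c - b))\<^sup>2 + (norm (b - a))\<^sup>2))
    = \<alpha> * (norm ((c - b) - (b - a)))\<^sup>2"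
    unfolding inertial_energy_def
    by (simp add: eqs, simp add: power2_norm_eq_inner field_simps)
  then show ?thesis using \<alpha> by (smt (verit) mult_nonneg_nonneg zero_le_power2)
qed

text \<open>
  Testing the step at the solution \<open>u\<close>: the penalty term \<open>b * f c u\<close> has the favourable sign
  by monotonicity and drops out, and strong monotonicity of \<open>g\<close> supplies the quadratic term.
\<close>

lemma proximal_step_distance:
  fixes K :: "'a::real_inner set"
  assumes f: "monotone_bifun K f" and g: "strongly_monotone_bifun \<rho> K g"
    and u: "u \<in> ep_solutions K f" and c: "c \<in> K" and pos: "0 < l" "0 < b"
    and step: "b * f c u + g c u + (1 / l) * ((c - w) \<bullet> (u - c)) \<ge> 0"
  shows "(c - w) \<bullet> (c - u) \<le> l * (- g u c - \<rho> * (norm (c - u))\<^sup>2)"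
proof -
  have uK: "u \<in> K" and "0 \<le> f u c" using u c by (auto simp: ep_solutions_def)
  with f c have "f c u \<le> 0" by (fastforce simp: monotone_bifun_def)
  then have "b * f c u \<le> 0" using pos by (simp add: mult_nonneg_nonpos)
  moreover have "g c u \<le> - g u c - \<rho> * (norm (c - u))\<^sup>2"
    using g c uK by (fastforce simp: strongly_monotone_bifun_def)
  moreover have "(c - w) \<bullet> (u - c) = - ((c - w) \<bullet> (c - u))"
    by (simp add: inner_diff_right)
  ultimately have "(1 / l) * ((c - w) \<bullet> (c - u)) \<le> - g u c - \<rho> * (norm (c - u))\<^sup>2"
    using step by simp
  then show ?thesis using pos by (simp add: field_simps)
qed

text \<open>
  Testing the step at an arbitrary \<open>y\<close> and dividing by \<open>b\<close>. The subgradient \<open>q\<close> bounds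
  \<open>g c y \<le> - g y c\<close> by a quantity that is linear in the distance, so that only \<open>1 / b\<close> and
  the ratio of the displacement to \<open>l * b\<close> govern the right-hand side.
\<close>

lemma proximal_step_feasibility:
  fixes K :: "'a::real_inner set"
  assumes f: "monotone_bifun K f" and g: "monotone_bifun K g"
    and y: "y \<in> K" and c: "c \<in> K" and pos: "0 < l" "0 < b"
    and q: "q \<bullet> (c - y) \<le> g y c"
    and step: "b * f c y + g c y + (1 / l) * ((c - w) \<bullet> (y - c)) \<ge> 0"
  shows "f y c \<le> norm q * norm (c - y) / b + norm (c - w) * norm (c - y) / (l * b)"
proof -
  have "f y c \<le> - f c y" "g c y \<le> - g y c"
    using f g y c by (fastforce simp: monotone_bifun_def)+
  have "- (q \<bullet> (c - y)) \<le> norm q * norm (c - y)"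
    using Cauchy_Schwarz_ineq2[of q "c - y"] by linarith
  then have gc: "g c y \<le> norm q * norm (c - y)"
    using \<open>g c y \<le> - g y c\<close> q by linarith
  have "(c - w) \<bullet> (y - c) \<le> norm (c - w) * norm (c - y)"
    using norm_cauchy_schwarz[of "c - w" "y - c"] by (simp add: norm_minus_commute)
  then have "(1 / l) * ((c - w) \<bullet> (y - c)) \<le> (1 / l) * (norm (c - w) * norm (c - y))"
    using pos by (intro mult_left_mono) auto
  moreover have "b * f y c \<le> b * (- f c y)"
    using \<open>f y c \<le> - f c y\<close> pos by (intro mult_left_mono) auto
  ultimately have "b * f y c \<le> norm q * norm (c - y) + (1 / l) * (norm (c - w) * norm (c - y))"
    using gc step by simp
  then have "f y c \<le> (norm q * norm (c - y) + (1 / l) * (norm (c - w) * norm (c - y))) / b"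
    using pos by (simp add: pos_le_divide_eq mult.commute)
  then show ?thesis by (simp add: add_divide_distrib)
qed

lemma proximal_sequence_asymptotically_feasible:
  fixes K :: "'a::real_inner set"
  assumes f: "monotone_bifun K f" and g: "monotone_bifun K g" "equilibrium_bifun K g"
    and sd: "subdifferential (extend_by_infinity K (g y)) y \<noteq> {}"
    and y: "y \<in> K" and sK: "\<And>n. s n \<in> K" and bd: "bounded (range s)"
    and pos: "\<And>n. 0 < lam n" "\<And>n. 0 < \<beta> n" and \<beta>: "filterlim \<beta> at_top sequentially"
    and cpos: "0 < c" and lb: "\<forall>\<^sub>F n in sequentially. c \<le> lam n * \<beta> n"
    and step: "\<And>n. \<beta> n * f (s n) y + g (s n) y + (1 / lam n) * ((s n - w n) \<bullet> (y - s n)) \<ge> 0"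
    and small: "\<And>\<delta>. 0 < \<delta> \<Longrightarrow> \<forall>\<^sub>F n in sequentially. P n \<longrightarrow> norm (s n - w n) \<le> \<delta>"
    and e: "0 < e"
  shows "\<forall>\<^sub>F n in sequentially. P n \<longrightarrow> f y (s n) \<le> e"
proof -
  obtain q where q: "\<And>z. z \<in> K \<Longrightarrow> q \<bullet> (z - y) \<le> g y z"
    using equilibrium_subgradient[OF g(2) y sd] by blast
  obtain B where B: "\<And>n. norm (s n) \<le> B" using bd by (auto simp: bounded_iff)
  define R where "R = B + norm y + 1"
  have R: "norm (s n - y) \<le> R" for n
    using norm_triangle_ineq4[of "s n" y] B[of n] by (simp add: R_def)
  have "0 \<le> B" using B[of 0] norm_ge_zero order_trans by blast
  then have Rpos: "0 < R" by (simp add: R_def add_nonneg_pos)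
  note lb
  moreover have "\<forall>\<^sub>F n in sequentially. 2 * norm q * R / e \<le> \<beta> n"
    using \<beta> by (simp add: filterlim_at_top)
  moreover have "\<forall>\<^sub>F n in sequentially. P n \<longrightarrow> norm (s n - w n) \<le> e * c / (2 * R)"
    using e cpos Rpos by (intro small) simp
  ultimately show ?thesis
  proof eventually_elim
    case (elim n)
    show ?case
    proof
      assume "P n"
      with elim have d: "norm (s n - w n) \<le> e * c / (2 * R)" by simp
      have "norm q * norm (s n - y) / \<beta> n \<le> norm q * R / \<beta> n"
        using R pos(2)[of n] by (intro divide_right_mono mult_left_mono) auto
      also have "\<dots> \<le> e / 2"
        using elim(2) e pos(2)[of n] by (simp add: field_simps)
      finally have 1: "norm q * norm (s n - y) / \<beta> n \<le> e / 2" .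
      have "norm (s n - w n) * norm (s n - y) / (lam n * \<beta> n) \<le> (e * c / (2 * R) * R) / c"
        using d R elim(1) cpos e Rpos
        by (intro frac_le mult_mono) auto
      also have "\<dots> = e / 2" using cpos Rpos by simp
      finally have 2: "norm (s n - w n) * norm (s n - y) / (lam n * \<beta> n) \<le> e / 2" .
      show "f y (s n) \<le> e"
        using proximal_step_feasibility[OF f g(1) y sK[of n] pos(1)[of n] pos(2)[of n] q[OF sK] step[of n]] 1 2
        by linarith
    qed
  qed
qed

section \<open>Convergence\<close>

text \<open>
  If \<open>E\<close> stayed above \<open>\<epsilon>\<close> it would decrease by multiples of a divergent series; and once
  below \<open>\<epsilon>\<close> it cannot climb back, since arriving above \<open>\<epsilon>\<close> presupposes a decrease.
\<close>

lemma tendsto_zero_of_conditional_descent: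
  fixes E lam :: "nat \<Rightarrow> real"
  assumes E: "\<And>n. 0 \<le> E n" and lam: "\<And>n. 0 \<le> lam n"
    and div: "filterlim (\<lambda>N. \<Sum>n\<le>N. lam n) at_top sequentially"
    and desc: "\<And>\<epsilon>. 0 < \<epsilon> \<Longrightarrow>
      \<exists>\<kappa>>0. \<forall>\<^sub>F n in sequentially. \<epsilon> \<le> E (Suc n) \<longrightarrow> E (Suc n) \<le> E n - \<kappa> * lam n"
  shows "E \<longlonglongrightarrow> 0"
proof (rule LIMSEQ_I)
  fix \<epsilon> :: real assume \<epsilon>: "0 < \<epsilon>"
  obtain \<kappa> N where \<kappa>: "0 < \<kappa>"
    and d: "\<And>n. N \<le> n \<Longrightarrow> \<epsilon> \<le> E (Suc n) \<Longrightarrow> E (Suc n) \<le> E n - \<kappa> * lam n"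
    using desc[OF \<epsilon>] by (auto simp: eventually_sequentially)
  have "\<exists>m\<ge>N. E (Suc m) < \<epsilon>"
  proof (rule ccontr)
    assume "\<not> ?thesis"
    then have big: "\<epsilon> \<le> E (Suc m)" if "N \<le> m" for m using that by force
    have tel: "E (Suc m) + \<kappa> * (\<Sum>n\<le>m. lam n) \<le> E N + \<kappa> * (\<Sum>n\<le>N. lam n)" if "N \<le> m" for m
      using that
    proof (induction m rule: dec_induct)
      case base
      have "0 \<le> \<kappa> * lam N" using \<kappa> lam by simp
      then show ?case using d[OF order_refl big[OF order_refl]] by simp
    next
      case (step m)
      then show ?case using d[of "Suc m"] big[of "Suc m"] by (simp add: distrib_left)
    qed
    have "\<forall>\<^sub>F m in sequentially. (E N + \<kappa> * (\<Sum>n\<le>N. lam n)) / \<kappa> + 1 \<le> (\<Sum>n\<le>m. lam n)"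
      using div by (simp add: filterlim_at_top)
    then have "\<forall>\<^sub>F m in sequentially. False"
      using eventually_ge_at_top[of N]
    proof eventually_elim
      case (elim m)
      have "E N + \<kappa> * (\<Sum>n\<le>N. lam n) < \<kappa> * (\<Sum>n\<le>m. lam n)"
        using elim(1) \<kappa> by (simp add: field_simps)
      with tel[OF elim(2)] E[of "Suc m"] show False by linarith
    qed
    then show False by simp
  qed
  then obtain m where m: "N \<le> m" "E (Suc m) < \<epsilon>" by blast
  have "E n < \<epsilon>" if "Suc m \<le> n" for n
    using that
  proof (induction n rule: dec_induct)
    case base
    show ?case by (rule m)
  next
    case (step n)
    have "0 \<le> \<kappa> * lam n" using \<kappa> lam by simp
    then show ?case using d[of n] step m by fastforce
  qed
  then show "\<exists>no. \<forall>n\<ge>no. norm (E n - 0) < \<epsilon>" using E by (auto intro!: exI[of _ "Suc m"])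
qed

text \<open>
  The energy can grow only if \<open>Q * r n - \<rho> * (r n)\<^sup>2 > 0\<close>, that is, only if \<open>r n < Q / \<rho>\<close>;
  then the step inequality bounds \<open>D n\<close> as well, and the new energy is below an absolute constant.
\<close>

lemma perturbed_energy_bounded:
  fixes E D r lam :: "nat \<Rightarrow> real"
  assumes pos: "0 < \<gamma>" "0 < \<rho>" "0 \<le> Q" and nonneg: "\<And>n. 0 \<le> D n" "\<And>n. 0 \<le> r n"
    and lam: "\<And>n. 0 < lam n" "\<And>n. lam n \<le> L"
    and upper: "\<And>n. E (Suc n) \<le> (r n)\<^sup>2 + D n"
    and step: "\<And>n. E (Suc n) + \<gamma> * D n \<le> E n + 2 * lam n * (Q * r n - \<rho> * (r n)\<^sup>2)"
  shows "\<exists>B. \<forall>n. E n \<le> B"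
proof -
  define C where "C = (Q / \<rho>)\<^sup>2 + 2 * L * (Q * (Q / \<rho>)) / \<gamma>"
  have "E n \<le> max (E 0) C" for n
  proof (induction n)
    case 0
    show ?case by simp
  next
    case (Suc n)
    show ?case
    proof (cases "E (Suc n) \<le> E n")
      case True
      then show ?thesis using Suc by simp
    next
      case False
      have D0: "0 \<le> \<gamma> * D n" using pos nonneg by simp
      with False step[of n] have "0 < 2 * lam n * (Q * r n - \<rho> * (r n)\<^sup>2)" by linarith
      then have "\<rho> * (r n)\<^sup>2 < Q * r n" using lam(1)[of n] by (simp add: zero_less_mult_iff)
      then have "0 < r n * (Q - \<rho> * r n)" by (simp add: algebra_simps power2_eq_square)
      then have "\<rho> * r n \<le> Q" using nonneg(2)[of n] by (simp add: zero_less_mult_iff)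
      then have r: "r n \<le> Q / \<rho>" using pos by (simp add: field_simps)
      have "\<gamma> * D n \<le> 2 * lam n * (Q * r n - \<rho> * (r n)\<^sup>2)" using False step[of n] by linarith
      also have "\<dots> \<le> 2 * L * (Q * (Q / \<rho>))"
      proof (rule mult_mono)
        have "0 \<le> \<rho> * (r n)\<^sup>2" using pos by simp
        moreover have "Q * r n \<le> Q * (Q / \<rho>)" using r pos by (intro mult_left_mono)
        ultimately show "Q * r n - \<rho> * (r n)\<^sup>2 \<le> Q * (Q / \<rho>)" by linarith
        show "0 \<le> Q * r n - \<rho> * (r n)\<^sup>2" using \<open>\<rho> * (r n)\<^sup>2 < Q * r n\<close> by simp
        show "2 * lam n \<le> 2 * L" "0 \<le> 2 * L" using lam(1,2)[of n] by auto
      qed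
      finally have "D n \<le> 2 * L * (Q * (Q / \<rho>)) / \<gamma>" using pos by (simp add: field_simps)
      moreover have "(r n)\<^sup>2 \<le> (Q / \<rho>)\<^sup>2" using r nonneg by (intro power_mono)
      ultimately have "E (Suc n) \<le> C" using upper[of n] unfolding C_def by linarith
      then show ?thesis by simp
    qed
  qed
  then show ?thesis by blast
qed

theorem theorem3:
  fixes K :: "'a::{real_inner, complete_space} set"
    and f g :: "'a \<Rightarrow> 'a \<Rightarrow> real"
    and \<rho> \<alpha> :: real
    and lam \<beta> :: "nat \<Rightarrow> real"
    and x :: "nat \<Rightarrow> 'a"
  assumes "K \<noteq> {}" and "closed K" and "convex K"
    and "monotone_bifun K f" and "upper_hemicontinuous K f" and "equilibrium_bifun K f"
    and "monotone_bifun K g" and "upper_hemicontinuous K g" and "equilibrium_bifun K g"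
    and "bep_solutions K f g \<noteq> {}"
    and "\<forall>y\<in>K. subdifferential (extend_by_infinity K (g y)) y \<noteq> {}"
    and "K \<inter> ep_solutions K f \<noteq> {}"
    and "subspace (cone_of_differences K (ep_solutions K f))"
    and "closed (cone_of_differences K (ep_solutions K f))"
    and "ep_solutions K f \<noteq> {}"
    and "\<rho> > 0" and "strongly_monotone_bifun \<rho> K g"
    and "\<forall>n. lam n > 0" and "\<forall>n. \<beta> n > 0"
    and "lam \<longlonglongrightarrow> 0"
    and "filterlim (\<lambda>N. \<Sum>n\<le>N. lam n) at_top sequentially"
    and "filterlim \<beta> at_top sequentially"
    and "liminf (\<lambda>n. ereal (lam n * \<beta> n)) > 0"
    and "0 \<le> \<alpha>" and "\<alpha> < 1 / 3"
    and "\<forall>n. x n \<in> K"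
    and "\<forall>n\<ge>1. let y\<^sub>n = x n + \<alpha> *\<^sub>R (x n - x (n - 1)) in
           \<forall>y\<in>K. \<beta> n * f (x (n + 1)) y + g (x (n + 1)) y
                   + (1 / lam n) * ((x (n + 1) - y\<^sub>n) \<bullet> (y - x (n + 1))) \<ge> 0"
  shows "\<exists>u. bep_solutions K f g = {u} \<and> x \<longlonglongrightarrow> u"
proof -
  have \<alpha>: "0 \<le> \<alpha>" "\<alpha> < 1/3" using assms(24,25) by auto
  obtain u where u: "u \<in> bep_solutions K f g" using assms(10) by blast
  then have uS: "u \<in> ep_solutions K f" and uK: "u \<in> K"
    by (auto simp: bep_solutions_def ep_solutions_def)
  have unique: "bep_solutions K f g = {u}"
    using bep_solution_unique[OF assms(17,16) _ u] u by blast
  have xK: "x n \<in> K" for n using assms(26) by blast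
  obtain q where q: "\<And>z. z \<in> K \<Longrightarrow> q \<bullet> (z - u) \<le> g u z"
    using equilibrium_subgradient[OF assms(9) uK] assms(11) uK by blast

  \<comment> \<open>The recursion starts at index 1; with the indices shifted by one it holds for all \<open>n\<close>.\<close>
  define l where "l n = lam (Suc n)" for n
  define b where "b n = \<beta> (Suc n)" for n
  define s where "s n = x (Suc (Suc n))" for n
  define w where "w n = x (Suc n) + \<alpha> *\<^sub>R (x (Suc n) - x n)" for n
  define E where "E n = inertial_energy \<alpha> u (x n) (x (Suc n))" for n
  define D where "D n = (norm (s n - x (Suc n)))\<^sup>2 + (norm (x (Suc n) - x n))\<^sup>2" for n
  define \<gamma> where "\<gamma> = (1 - 3 * \<alpha>) / 2"
  have \<gamma>: "0 < \<gamma>" using \<alpha> by (simp add: \<gamma>_def)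
  have pos: "0 < l n" "0 < b n" for n using assms(18,19) by (auto simp: l_def b_def)
  have sK: "s n \<in> K" for n by (simp add: s_def xK)
  have D0: "0 \<le> D n" for n by (simp add: D_def)
  have prox: "b n * f (s n) y + g (s n) y + (1 / l n) * ((s n - w n) \<bullet> (y - s n)) \<ge> 0"
    if "y \<in> K" for n y
    using assms(27)[rule_format, of "Suc n"] that
    by (simp add: Let_def l_def b_def s_def w_def)
  have l0: "l \<longlonglongrightarrow> 0" unfolding l_def by (rule LIMSEQ_Suc[OF assms(20)])
  have binf: "filterlim b at_top sequentially"
    unfolding b_def using assms(22) filterlim_sequentially_Suc by blast
  obtain c where c: "0 < c" "\<forall>\<^sub>F n in sequentially. c \<le> l n * b n"
  proof -
    obtain c where c: "0 < ereal c" "ereal c < liminf (\<lambda>n. ereal (lam n * \<beta> n))"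
      using ereal_dense2[OF assms(23)] by blast
    from less_LiminfD[OF c(2)] have "\<forall>\<^sub>F n in sequentially. c \<le> lam n * \<beta> n"
      by eventually_elim simp
    with c(1) show thesis
      by (intro that) (auto simp: l_def b_def eventually_sequentially_Suc[of "\<lambda>n. c \<le> lam n * \<beta> n"])
  qed
  have ldiv: "filterlim (\<lambda>N. \<Sum>n\<le>N. l n) at_top sequentially"
  proof -
    have "filterlim (\<lambda>N. \<Sum>n\<le>Suc N. lam n) at_top sequentially"
      using assms(21) filterlim_sequentially_Suc[of "\<lambda>N. \<Sum>n\<le>N. lam n"] by simp
    then have "filterlim (\<lambda>N. - lam 0 + (\<Sum>n\<le>Suc N. lam n)) at_top sequentially"
      by (rule filterlim_tendsto_add_at_top[OF tendsto_const])
    moreover have "- lam 0 + (\<Sum>n\<le>Suc N. lam n) = (\<Sum>n\<le>N. l n)" for N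
      unfolding sum.atMost_Suc_shift l_def by simp
    ultimately show ?thesis by simp
  qed

  have gl: "- g u (s n) \<le> norm q * norm (s n - u)" for n
    using q[OF sK, of n] Cauchy_Schwarz_ineq2[of q "s n - u"] by linarith
  have step: "E (Suc n) + \<gamma> * D n \<le> E n + 2 * l n * (- g u (s n) - \<rho> * (norm (s n - u))\<^sup>2)" for n
    using inertial_energy_step[OF \<alpha>(1), of u "x (Suc n)" "s n" "x n"]
      proximal_step_distance[OF assms(4,17) uS sK pos prox[OF uK], of n]
    by (simp add: E_def D_def s_def w_def \<gamma>_def)
  have Eupper: "E (Suc n) \<le> (norm (s n - u))\<^sup>2 + D n" for n
    using inertial_energy_upper[OF \<alpha>, of u "x (Suc n)" "s n"]
    by (simp add: E_def D_def s_def add_increasing2 order_trans)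
  have Elower: "(norm (x (Suc n) - u))\<^sup>2 / 3 \<le> E n" for n
    unfolding E_def by (rule inertial_energy_lower[OF \<alpha>])
  have E0: "0 \<le> E n" for n
    using Elower[of n] by (rule order_trans[rotated]) simp

  obtain L where L: "\<And>n. l n \<le> L"
    using convergent_imp_bounded[OF l0] by (auto simp: bounded_iff dest: abs_le_D1)
  have "\<exists>B. \<forall>n. E n \<le> B"
  proof (rule perturbed_energy_bounded[where D = D and r = "\<lambda>n. norm (s n - u)" and Q = "norm q",
        OF \<gamma> assms(16) _ _ _ pos(1) L Eupper])
    fix n
    have "2 * l n * (- g u (s n) - \<rho> * (norm (s n - u))\<^sup>2)
        \<le> 2 * l n * (norm q * norm (s n - u) - \<rho> * (norm (s n - u))\<^sup>2)"
      using gl[of n] pos(1)[of n] by (intro mult_left_mono) auto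
    with step[of n] show "E (Suc n) + \<gamma> * D n
        \<le> E n + 2 * l n * (norm q * norm (s n - u) - \<rho> * (norm (s n - u))\<^sup>2)"
      by linarith
  qed (auto simp: D0)
  then obtain B where B: "\<And>n. E n \<le> B" by blast
  define R where "R = sqrt (3 * B)"
  have R: "norm (s n - u) \<le> R" for n
    using Elower[of "Suc n"] B[of "Suc n"] unfolding R_def s_def
    by (intro real_le_rsqrt) linarith
  have bd: "bounded (range s)"
    unfolding bounded_def using R by (auto simp: dist_norm norm_minus_commute intro!: exI[of _ u])

  have "E \<longlonglongrightarrow> 0"
  proof (rule tendsto_zero_of_conditional_descent[OF E0 _ ldiv])
    fix \<epsilon> :: real assume \<epsilon>: "0 < \<epsilon>"
    define \<kappa> where "\<kappa> = \<rho> * \<epsilon>"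
    have \<kappa>: "0 < \<kappa>" using \<epsilon> assms(16) by (simp add: \<kappa>_def)
    \<comment> \<open>the bad indices, shown below to be finitely many\<close>
    define P where "P n \<longleftrightarrow> \<epsilon> \<le> E (Suc n) \<and> E n - \<kappa> * l n < E (Suc n)" for n
    define M where "M = 2 * (norm q * R) + \<kappa>"
    have PD: "\<gamma> * D n < l n * (2 * (- g u (s n)) - 2 * \<rho> * (norm (s n - u))\<^sup>2 + \<kappa>)" if "P n" for n
      using step[of n] that by (simp add: P_def algebra_simps)
    \<comment> \<open>\<open>l n * M\<close> bounds the right-hand side of \<open>PD\<close>.\<close>
    have smallD: "\<forall>\<^sub>F n in sequentially. P n \<longrightarrow> D n \<le> \<delta>" if \<delta>: "0 < \<delta>" for \<delta>
    proof -
      have "(\<lambda>n. l n * M / \<gamma>) \<longlonglongrightarrow> 0 * M / \<gamma>" by (intro tendsto_intros l0) (use \<gamma> in simp)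
      then have "\<forall>\<^sub>F n in sequentially. l n * M / \<gamma> < \<delta>"
        using \<delta> by (simp add: order_tendstoD(2))
      then show ?thesis
      proof eventually_elim
        case (elim n)
        show ?case
        proof
          assume "P n"
          have "norm q * norm (s n - u) \<le> norm q * R" using R by (intro mult_left_mono) auto
          moreover have "0 \<le> \<rho> * (norm (s n - u))\<^sup>2" using assms(16) by simp
          ultimately have "2 * (- g u (s n)) - 2 * \<rho> * (norm (s n - u))\<^sup>2 + \<kappa> \<le> M"
            using gl[of n] by (simp add: M_def)
          then have "l n * (2 * (- g u (s n)) - 2 * \<rho> * (norm (s n - u))\<^sup>2 + \<kappa>) \<le> l n * M"
            using pos(1)[of n] by (intro mult_left_mono) auto
          with PD[OF \<open>P n\<close>] have "\<gamma> * D n < l n * M" by linarith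
          then have "D n < l n * M / \<gamma>" using \<gamma> by (simp add: field_simps)
          with elim show "D n \<le> \<delta>" by linarith
        qed
      qed
    qed
    have smallw: "\<forall>\<^sub>F n in sequentially. P n \<longrightarrow> norm (s n - w n) \<le> \<delta>" if \<delta>: "0 < \<delta>" for \<delta>
    proof -
      from \<delta> have "0 < (\<delta> / 2)\<^sup>2" by simp
      from smallD[OF this] show ?thesis
      proof eventually_elim
        case (elim n)
        show ?case
        proof
          assume "P n"
          with elim have D: "D n \<le> (\<delta> / 2)\<^sup>2" by simp
          then have "(norm (s n - x (Suc n)))\<^sup>2 \<le> (\<delta> / 2)\<^sup>2" "(norm (x (Suc n) - x n))\<^sup>2 \<le> (\<delta> / 2)\<^sup>2"
            unfolding D_def by (smt (verit) zero_le_power2)+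
          then have n: "norm (s n - x (Suc n)) \<le> \<delta> / 2" "norm (x (Suc n) - x n) \<le> \<delta> / 2"
            using \<delta> by (auto intro: power2_le_imp_le)
          have "norm (s n - w n) \<le> norm (s n - x (Suc n)) + norm (\<alpha> *\<^sub>R (x (Suc n) - x n))"
            unfolding w_def diff_diff_eq[symmetric] by (rule norm_triangle_ineq4)
          also have "norm (\<alpha> *\<^sub>R (x (Suc n) - x n)) \<le> 1 * norm (x (Suc n) - x n)"
            using \<alpha> unfolding norm_scaleR by (intro mult_right_mono) auto
          finally show "norm (s n - w n) \<le> \<delta>" using n by simp
        qed
      qed
    qed
    \<comment> \<open>The tolerance \<open>\<rho> * \<epsilon> / 4\<close> and the bound \<open>\<epsilon> / 4\<close> on \<open>D n\<close> make the right-hand side of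
      \<open>PD\<close> nonpositive: \<open>2 * (1/4) - 2 * (3/4) + 1 = 0\<close>, in units of \<open>\<rho> * \<epsilon>\<close>.\<close>
    have "\<forall>\<^sub>F n in sequentially. P n \<longrightarrow> - (\<rho> * \<epsilon> / 4) < g u (s n)"
    proof (rule asymptotically_feasible_upper_value[OF assms(2,3,5,6,9) u sK bd])
      fix y and e :: real assume y: "y \<in> K" and e: "0 < e"
      show "\<forall>\<^sub>F n in sequentially. P n \<longrightarrow> f y (s n) \<le> e"
        by (rule proximal_sequence_asymptotically_feasible[OF assms(4,7,9) _ y sK bd pos binf c
              prox[OF y] smallw e])
          (use assms(11) y in auto)
    qed (use \<epsilon> assms(16) in simp)
    moreover have "\<forall>\<^sub>F n in sequentially. P n \<longrightarrow> D n \<le> \<epsilon> / 4"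
      using \<epsilon> by (intro smallD) simp
    ultimately have "\<forall>\<^sub>F n in sequentially. \<epsilon> \<le> E (Suc n) \<longrightarrow> E (Suc n) \<le> E n - \<kappa> * l n"
    proof eventually_elim
      case (elim n)
      have False if P: "P n"
      proof -
        have "3 * \<epsilon> / 4 \<le> (norm (s n - u))\<^sup>2"
          using P elim(2) Eupper[of n] by (simp add: P_def)
        then have "\<rho> * (3 * \<epsilon> / 4) \<le> \<rho> * (norm (s n - u))\<^sup>2"
          using assms(16) by (intro mult_left_mono) auto
        then have "2 * (- g u (s n)) - 2 * \<rho> * (norm (s n - u))\<^sup>2 + \<kappa> \<le> 0"
          using elim(1) P by (simp add: \<kappa>_def)
        then have "l n * (2 * (- g u (s n)) - 2 * \<rho> * (norm (s n - u))\<^sup>2 + \<kappa>) \<le> 0"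
          using pos(1)[of n] by (intro mult_nonneg_nonpos) auto
        moreover have "0 \<le> \<gamma> * D n" using \<gamma> D0 by simp
        ultimately show False using PD[OF P] by linarith
      qed
      then show ?case unfolding P_def by force
    qed
    with \<kappa> show "\<exists>\<kappa>>0. \<forall>\<^sub>F n in sequentially. \<epsilon> \<le> E (Suc n) \<longrightarrow> E (Suc n) \<le> E n - \<kappa> * l n"
      by blast
  qed (use pos in \<open>simp add: less_imp_le\<close>)
  then have "(\<lambda>n. sqrt (3 * E n)) \<longlonglongrightarrow> sqrt (3 * 0)" by (intro tendsto_intros)
  then have "(\<lambda>n. sqrt (3 * E n)) \<longlonglongrightarrow> 0" by simp
  then have "(\<lambda>n. x (Suc n) - u) \<longlonglongrightarrow> 0"
  proof (rule Lim_null_comparison[rotated])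
    have "norm (x (Suc n) - u) \<le> sqrt (3 * E n)" for n
      using Elower[of n] by (intro real_le_rsqrt) linarith
    then show "\<forall>\<^sub>F n in sequentially. norm (x (Suc n) - u) \<le> sqrt (3 * E n)" by simp
  qed
  then have "x \<longlonglongrightarrow> u" by (simp add: LIM_zero_iff filterlim_sequentially_Suc[of x])
  with unique show ?thesis by blast
qed

end
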